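(* Let $\mathcal{I}$ be an ideal on $\omega$ and let $\bm{x}=(x_n:n\in\omega)$ be a sequence taking values in a regular topological space $X$ such that $\{n\in\omega:x_n\notin K\}\in\mathcal{I}$ for some compact $K\subseteq X$. Let also $\mathscr{F}=\{F_\eta:\eta\in X\}$ be a rough family on $X$. Then $$\{\eta\in X:F_\eta\cap\Gamma_{\bm{x}}(\mathcal{I})\neq\emptyset\}\subseteq\Gamma_{\bm{x}}(\mathcal{I},\mathscr{F})\subseteq\{\eta\in X:\overline{F_\eta}\cap\Gamma_{\bm{x}}(\mathcal{I})\neq\emptyset\}.$$ In particular, if each $F_\eta$ is closed, then $\Gamma_{\bm{x}}(\mathcal{I},\mathscr{F})=\{\eta\in X:F_\eta\cap\Gamma_{\bm{x}}(\mathcal{I})\neq\emptyset\}$.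
   Context: $\omega$ is the set of nonnegative integers. An ideal $\mathcal{I}$ on $\omega$ is a family $\mathcal{I}\subseteq\mathcal{P}(\omega)$ closed under subsets and finite unions, containing all finite subsets of $\omega$, and with $\omega\notin\mathcal{I}$. A rough family on a topological space $X$ is a collection $\mathscr{F}=\{F_\eta:\eta\in X\}$ of subsets of $X$ such that $\eta\in F_\eta$ for all $\eta\in X$. For a sequence $\bm{x}=(x_n:n\in\omega)$ in $X$, $\Gamma_{\bm{x}}(\mathcal{I},\mathscr{F})$ is the set of all $(\mathcal{I},\mathscr{F})$-cluster points of $\bm{x}$, i.e. of all $\eta\in X$ such that $\{n\in\omega:x_n\in U\}\notin\mathcal{I}$ for all open sets $U\subseteq X$ with $F_\eta\subseteq U$. $\Gamma_{\bm{x}}(\mathcal{I})$ is this set for the rough family of singletons $F_\eta=\{\eta\}$, i.e. the set of $\eta\in X$ such that $\{n\in\omega:x_n\in U\}\notin\mathcal{I}$ for all open neighborhoods $U$ of $\eta$. $\overline{S}$ denotes the closure of $S\subseteq X$. *)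

theory Defs
  imports "HOL-Analysis.Analysis"
begin

definition ideal_on_nat :: "nat set set \<Rightarrow> bool" where
  "ideal_on_nat \<I> \<longleftrightarrow>
     (\<forall>A\<in>\<I>. \<forall>B. B \<subseteq> A \<longrightarrow> B \<in> \<I>) \<and>
     (\<forall>A\<in>\<I>. \<forall>B\<in>\<I>. A \<union> B \<in> \<I>) \<and>
     (\<forall>A. finite A \<longrightarrow> A \<in> \<I>) \<and>
     UNIV \<notin> \<I>"

(* A family indexed by the points of the space is a total function on the carrier
   type; its values outside "topspace X" are never used. *)
definition rough_family :: "'a topology \<Rightarrow> ('a \<Rightarrow> 'a set) \<Rightarrow> bool" where
  "rough_family X F \<longleftrightarrow> (\<forall>\<eta>\<in>topspace X. F \<eta> \<subseteq> topspace X \<and> \<eta> \<in> F \<eta>)"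

definition rough_cluster_points ::
    "'a topology \<Rightarrow> (nat \<Rightarrow> 'a) \<Rightarrow> nat set set \<Rightarrow> ('a \<Rightarrow> 'a set) \<Rightarrow> 'a set" where
  "rough_cluster_points X x \<I> F =
     {\<eta> \<in> topspace X. \<forall>U. openin X U \<and> F \<eta> \<subseteq> U \<longrightarrow> {n. x n \<in> U} \<notin> \<I>}"

definition ideal_cluster_points ::
    "'a topology \<Rightarrow> (nat \<Rightarrow> 'a) \<Rightarrow> nat set set \<Rightarrow> 'a set" where
  "ideal_cluster_points X x \<I> = rough_cluster_points X x \<I> (\<lambda>\<eta>. {\<eta>})"

end

theory Submission
  imports Defs
begin

text \<open>If no cluster point lies in the closed set \<open>C = \<close> closure of \<open>F \<eta>\<close>, then by compactness
  \<open>C \<inter> K\<close> is covered by an open \<open>V\<close> that the sequence visits only along a set in the ideal. The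
  compact set \<open>K - V\<close> misses \<open>C\<close>, so regularity yields an open \<open>W \<supseteq> C\<close> disjoint from \<open>K - V\<close>, and
  the sequence visits \<open>W\<close> only when it is outside \<open>K\<close> or inside \<open>V\<close>.\<close>

lemma ideal_on_nat_subset: "\<lbrakk>ideal_on_nat \<I>; A \<in> \<I>; B \<subseteq> A\<rbrakk> \<Longrightarrow> B \<in> \<I>"
  unfolding ideal_on_nat_def by blast

lemma ideal_on_nat_Un: "\<lbrakk>ideal_on_nat \<I>; A \<in> \<I>; B \<in> \<I>\<rbrakk> \<Longrightarrow> A \<union> B \<in> \<I>"
  unfolding ideal_on_nat_def by blast

lemma ideal_on_nat_UN:
  assumes "ideal_on_nat \<I>" "finite S" "\<And>s. s \<in> S \<Longrightarrow> A s \<in> \<I>"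
  shows "(\<Union>s\<in>S. A s) \<in> \<I>"
  using assms(2,3)
proof (induction S rule: finite_induct)
  case empty
  then show ?case using assms(1) by (simp add: ideal_on_nat_def)
next
  case (insert s S)
  then show ?case using ideal_on_nat_Un[OF assms(1)] by simp
qed

text \<open>An open set containing \<open>F \<eta>\<close> is an open neighbourhood of every cluster
  point in \<open>F \<eta>\<close>, so the sequence visits it along a set outside the ideal.\<close>

lemma rough_cluster_points_if_meets:
  assumes "\<eta> \<in> topspace X" "F \<eta> \<inter> ideal_cluster_points X x \<I> \<noteq> {}"
  shows "\<eta> \<in> rough_cluster_points X x \<I> F"
  using assms unfolding ideal_cluster_points_def rough_cluster_points_def by blast

text \<open>Every point of \<open>C\<close> has an open neighbourhood visited only along a set in
  \<open>\<I>\<close>. Finitely many of these cover \<open>C\<close>, and \<open>\<I>\<close> is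
  closed under finite unions.\<close>

lemma open_cover_avoiding_cluster_points:
  assumes I: "ideal_on_nat \<I>" and C: "compactin X C"
    and disj: "C \<inter> ideal_cluster_points X x \<I> = {}"
  obtains V where "openin X V" "C \<subseteq> V" "{n. x n \<in> V} \<in> \<I>"
proof -
  define \<U> where "\<U> = {U. openin X U \<and> {n. x n \<in> U} \<in> \<I>}"
  have "C \<subseteq> \<Union>\<U>"
    using disj compactin_subset_topspace[OF C]
    unfolding \<U>_def ideal_cluster_points_def rough_cluster_points_def by blast
  moreover have "openin X U" if "U \<in> \<U>" for U
    using that by (simp add: \<U>_def)
  ultimately obtain \<G> where G: "finite \<G>" "\<G> \<subseteq> \<U>" "C \<subseteq> \<Union>\<G>"
    using compactinD[OF C, of \<U>] by blast
  have "(\<Union>U\<in>\<G>. {n. x n \<in> U}) \<in> \<I>"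
    using G by (intro ideal_on_nat_UN[OF I]) (auto simp: \<U>_def)
  moreover have "{n. x n \<in> \<Union>\<G>} = (\<Union>U\<in>\<G>. {n. x n \<in> U})"
    by blast
  ultimately show thesis
    using G by (intro that[of "\<Union>\<G>"]) (auto simp: \<U>_def)
qed

lemma closure_meets_if_rough_cluster_point:
  assumes I: "ideal_on_nat \<I>" and X: "regular_space X"
    and K: "compactin X K" "{n. x n \<notin> K} \<in> \<I>"
    and F: "F \<eta> \<subseteq> topspace X"
    and \<eta>: "\<eta> \<in> rough_cluster_points X x \<I> F"
  shows "X closure_of F \<eta> \<inter> ideal_cluster_points X x \<I> \<noteq> {}"
proof
  let ?C = "X closure_of F \<eta>"
  assume empty: "?C \<inter> ideal_cluster_points X x \<I> = {}"
  \<comment> \<open>\<open>?C\<close> itself may fail to be compact; cutting it down to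
    \<open>K\<close> makes the covering lemma applicable.\<close>
  have "compactin X (?C \<inter> K)"
    using K(1) by (simp add: closed_Int_compactin)
  then obtain V where V: "openin X V" "?C \<inter> K \<subseteq> V" "{n. x n \<in> V} \<in> \<I>"
    using open_cover_avoiding_cluster_points[OF I, of X "?C \<inter> K" x] empty by blast
  \<comment> \<open>A compact set need not be closed in a regular space without T1, so compactness
    of \<open>K - V\<close> is derived by writing it as a closed set intersected with
    \<open>K\<close>.\<close>
  have "K - V = (topspace X - V) \<inter> K"
    using compactin_subset_topspace[OF K(1)] by blast
  then have "compactin X (K - V)"
    using closed_Int_compactin[OF closedin_diff[OF closedin_topspace V(1)] K(1)] by simp
  moreover have "disjnt (K - V) ?C"
    using V(2) by (auto simp: disjnt_def)
  ultimately obtain W' W where W: "openin X W" "K - V \<subseteq> W'" "?C \<subseteq> W" "disjnt W' W"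
    using regular_space_compact_closed_separation[OF X, of "K - V" ?C] by auto
  \<comment> \<open>A term in both \<open>W\<close> and \<open>K\<close> cannot lie in
    \<open>K - V\<close>, which is inside \<open>W'\<close>, so it lies in \<open>V\<close>.\<close>
  have "{n. x n \<in> W} \<subseteq> {n. x n \<notin> K} \<union> {n. x n \<in> V}"
    using W(2,4) by (auto simp: disjnt_iff)
  then have "{n. x n \<in> W} \<in> \<I>"
    using ideal_on_nat_subset[OF I] ideal_on_nat_Un[OF I K(2) V(3)] by blast
  \<comment> \<open>\<open>X closure_of\<close> keeps only points of the space, hence the appeal to
    \<open>F \<eta> \<subseteq> topspace X\<close>.\<close>
  moreover have "F \<eta> \<subseteq> W"
    using closure_of_subset[OF F] W(3) by blast
  ultimately show False
    using \<eta> W(1) by (auto simp: rough_cluster_points_def)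
qed

theorem theorem2p2:
  fixes X :: "'a topology" and x :: "nat \<Rightarrow> 'a"
    and \<I> :: "nat set set" and F :: "'a \<Rightarrow> 'a set"
  assumes "ideal_on_nat \<I>"
    and "regular_space X"
    and "\<And>n. x n \<in> topspace X"
    and "\<exists>K. compactin X K \<and> {n. x n \<notin> K} \<in> \<I>"
    and "rough_family X F"
  shows "{\<eta> \<in> topspace X. F \<eta> \<inter> ideal_cluster_points X x \<I> \<noteq> {}}
           \<subseteq> rough_cluster_points X x \<I> F
       \<and> rough_cluster_points X x \<I> F
           \<subseteq> {\<eta> \<in> topspace X. (X closure_of F \<eta>) \<inter> ideal_cluster_points X x \<I> \<noteq> {}}
       \<and> ((\<forall>\<eta>\<in>topspace X. closedin X (F \<eta>)) \<longrightarrow>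
           rough_cluster_points X x \<I> F
             = {\<eta> \<in> topspace X. F \<eta> \<inter> ideal_cluster_points X x \<I> \<noteq> {}})"
proof -
  obtain K where K: "compactin X K" "{n. x n \<notin> K} \<in> \<I>"
    using assms(4) by blast
  have lower: "{\<eta> \<in> topspace X. F \<eta> \<inter> ideal_cluster_points X x \<I> \<noteq> {}}
      \<subseteq> rough_cluster_points X x \<I> F"
    by (blast intro: rough_cluster_points_if_meets)
  have "\<eta> \<in> topspace X \<and> X closure_of F \<eta> \<inter> ideal_cluster_points X x \<I> \<noteq> {}"
    if "\<eta> \<in> rough_cluster_points X x \<I> F" for \<eta>
  proof
    show top: "\<eta> \<in> topspace X"
      using that by (simp add: rough_cluster_points_def)
    then have "F \<eta> \<subseteq> topspace X"
      using assms(5) by (simp add: rough_family_def)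
    then show "X closure_of F \<eta> \<inter> ideal_cluster_points X x \<I> \<noteq> {}"
      using closure_meets_if_rough_cluster_point[OF assms(1,2) K] that by blast
  qed
  then have upper: "rough_cluster_points X x \<I> F
      \<subseteq> {\<eta> \<in> topspace X. X closure_of F \<eta> \<inter> ideal_cluster_points X x \<I> \<noteq> {}}"
    by blast
  have "rough_cluster_points X x \<I> F
      = {\<eta> \<in> topspace X. F \<eta> \<inter> ideal_cluster_points X x \<I> \<noteq> {}}"
    if "\<forall>\<eta>\<in>topspace X. closedin X (F \<eta>)"
  proof -
    \<comment> \<open>With closed values the upper bound becomes the lower one.\<close>
    have "X closure_of F \<eta> = F \<eta>" if "\<eta> \<in> topspace X" for \<eta>
      using that \<open>\<forall>\<eta>\<in>topspace X. closedin X (F \<eta>)\<close> by (simp add: closure_of_closedin)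
    then show ?thesis
      using lower upper by (intro equalityI) force+
  qed
  then show ?thesis
    using lower upper by blast
qed

end
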